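(* Let $n\ge 1$ and let $I = I(C_{2n+1})\subseteq K[x_1,\ldots,x_{2n+1}]$ be the edge ideal of the odd cycle $C_{2n+1}$. Then $I^{(t)} = I^t$ for all integers $t$ with $1 \le t \le n$.
   Context: $K$ is an algebraically closed field. $C_{2n+1}$ is the cycle graph with vertices $x_1,\ldots,x_{2n+1}$ and edges $\{x_j,x_{j+1}\}$ for $1\le j\le 2n$ and $\{x_{2n+1},x_1\}$. The edge ideal $I(G)$ of a simple graph $G$ on the variables is the ideal generated by all products $x_ix_j$ with $\{x_i,x_j\}$ an edge of $G$. The $m$th symbolic power of an ideal $I$ of a polynomial ring $S$ is $I^{(m)} = S\cap\bigcap_{P\in \mathrm{Ass}(I)} I^m S_P$. *)

theory Defs
  imports
    "HOL-Algebra.Ideal_Product"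
    "HOL-Library.Poly_Mapping"
    "HOL-Computational_Algebra.Polynomial"
    "HOL-Computational_Algebra.Fraction_Field"
begin

section \<open>Subrings of a type-class domain as ring records\<close>

definition subring_of_type :: "'a::comm_ring_1 set \<Rightarrow> 'a ring" where
  "subring_of_type A = \<lparr>carrier = A, monoid.mult = (*), one = 1, zero = 0, add = (+)\<rparr>"

lemma cring_subring_of_type:
  assumes "0 \<in> A" "1 \<in> A"
    and add: "\<And>a b. a \<in> A \<Longrightarrow> b \<in> A \<Longrightarrow> a + b \<in> A"
    and mult: "\<And>a b. a \<in> A \<Longrightarrow> b \<in> A \<Longrightarrow> a * b \<in> A"
    and uminus: "\<And>a. a \<in> A \<Longrightarrow> - a \<in> A"
  shows "cring (subring_of_type A)"
proof (rule cringI)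
  show "abelian_group (subring_of_type A)"
  proof (rule abelian_groupI)
    fix x assume "x \<in> carrier (subring_of_type A)"
    then show "\<exists>y\<in>carrier (subring_of_type A).
        y \<oplus>\<^bsub>subring_of_type A\<^esub> x = \<zero>\<^bsub>subring_of_type A\<^esub>"
      using uminus by (auto simp: subring_of_type_def intro!: bexI[of _ "- x"])
  qed (use assms in \<open>auto simp: subring_of_type_def algebra_simps\<close>)
  show "Group.comm_monoid (subring_of_type A)"
    by (rule comm_monoidI) (use assms in \<open>auto simp: subring_of_type_def algebra_simps\<close>)
qed (auto simp: subring_of_type_def algebra_simps)


section \<open>Polynomial rings\<close>

text \<open>
  An element of \<open>(nat \<Rightarrow>\<^sub>0 nat) \<Rightarrow>\<^sub>0 'k\<close> maps finitely many exponent vectors to their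
  nonzero coefficients; it is a polynomial in variables indexed by all natural numbers.
  The ring below only admits the variables indexed by \<open>V\<close>.
\<close>

type_synonym 'k mpoly = "(nat \<Rightarrow>\<^sub>0 nat) \<Rightarrow>\<^sub>0 'k"

definition mvar :: "nat \<Rightarrow> 'k::field mpoly" where
  "mvar i = Poly_Mapping.single (Poly_Mapping.single i 1) 1"

definition mpoly_ring :: "nat set \<Rightarrow> 'k::field mpoly ring" where
  "mpoly_ring V = subring_of_type {p. \<forall>m\<in>Poly_Mapping.keys p. Poly_Mapping.keys m \<subseteq> V}"

lemma cring_mpoly_ring: "cring (mpoly_ring V :: 'k::field mpoly ring)"
  unfolding mpoly_ring_def
proof (rule cring_subring_of_type)
  fix a b :: "'k mpoly"
  assume a: "a \<in> {p. \<forall>m\<in>Poly_Mapping.keys p. Poly_Mapping.keys m \<subseteq> V}"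
    and b: "b \<in> {p. \<forall>m\<in>Poly_Mapping.keys p. Poly_Mapping.keys m \<subseteq> V}"
  show "a + b \<in> {p. \<forall>m\<in>Poly_Mapping.keys p. Poly_Mapping.keys m \<subseteq> V}"
    using a b Poly_Mapping.keys_add[of a b] by blast
  have "Poly_Mapping.keys m \<subseteq> V" if m: "m \<in> Poly_Mapping.keys (a * b)" for m
  proof -
    obtain u v where uv: "u \<in> Poly_Mapping.keys a" "v \<in> Poly_Mapping.keys b" "m = u + v"
      using m keys_mult[of a b] by blast
    then show ?thesis
      using a b Poly_Mapping.keys_add[of u v] by blast
  qed
  then show "a * b \<in> {p. \<forall>m\<in>Poly_Mapping.keys p. Poly_Mapping.keys m \<subseteq> V}"
    by blast
qed (auto simp: in_keys_iff lookup_one when_def split: if_splits)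


section \<open>Symbolic powers of ideals\<close>

text \<open>
  The last equation says that \<open>P\<close> is the annihilator of the class of \<open>f\<close> in \<open>R / I\<close>.
\<close>

definition Ass :: "('a, 'b) ring_scheme \<Rightarrow> 'a set \<Rightarrow> 'a set set" where
  "Ass R I = {P. primeideal P R \<and>
     (\<exists>f\<in>carrier R. P = {a \<in> carrier R. a \<otimes>\<^bsub>R\<^esub> f \<in> I})}"

text \<open>
  For a subring \<open>R\<close> of a domain, the localization at a prime \<open>P\<close> is realized inside the
  field of fractions of that domain.
\<close>

definition localization :: "'a::idom ring \<Rightarrow> 'a set \<Rightarrow> 'a fract ring" where
  "localization R P = subring_of_type {Fract a s | a s. a \<in> carrier R \<and> s \<in> carrier R - P}"

definition extended_ideal :: "'a::idom ring \<Rightarrow> 'a set \<Rightarrow> 'a set \<Rightarrow> 'a fract set" where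
  "extended_ideal R P J = Idl\<^bsub>localization R P\<^esub> ((\<lambda>a. Fract a 1) ` J)"

abbreviation ideal_power :: "('a, 'b) ring_scheme \<Rightarrow> 'a set \<Rightarrow> nat \<Rightarrow> 'a set" where
  "ideal_power R I m \<equiv> I [^]\<^bsub>ideals_set R\<^esub> m"

definition symbolic_power :: "'a::idom ring \<Rightarrow> 'a set \<Rightarrow> nat \<Rightarrow> 'a set" where
  "symbolic_power R I m =
     {f \<in> carrier R. \<forall>P\<in>Ass R I. Fract f 1 \<in> extended_ideal R P (ideal_power R I m)}"

lemma cring_localization:
  assumes R: "R = subring_of_type A" and P: "primeideal P R"
  shows "cring (localization R P)"
proof -
  interpret primeideal P R by (rule P)
  have simps: "carrier R = A" "\<And>a b. a \<otimes>\<^bsub>R\<^esub> b = a * b" "\<And>a b. a \<oplus>\<^bsub>R\<^esub> b = a + b"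
    "\<zero>\<^bsub>R\<^esub> = 0" "\<one>\<^bsub>R\<^esub> = 1"
    by (simp_all add: R subring_of_type_def)
  have zero: "0 \<in> A" "0 \<in> P"
    using zero_closed additive_subgroup.zero_closed[OF is_additive_subgroup] by (simp_all add: simps)
  have one: "1 \<in> A"
    using one_closed by (simp add: simps)
  have one': "1 \<notin> P"
    using one_imp_carrier I_notcarr by (auto simp: simps)
  have add: "a + b \<in> A" if "a \<in> A" "b \<in> A" for a b
    using a_closed[of a b] that by (simp add: simps)
  have mult: "a * b \<in> A" if "a \<in> A" "b \<in> A" for a b
    using m_closed[of a b] that by (simp add: simps)
  have minus: "- a \<in> A" if "a \<in> A" for a
  proof -
    have "a + (\<ominus>\<^bsub>R\<^esub> a) = 0" "\<ominus>\<^bsub>R\<^esub> a \<in> A"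
      using r_neg[of a] a_inv_closed[of a] that by (simp_all add: simps)
    then show ?thesis using Groups.minus_unique[of a "\<ominus>\<^bsub>R\<^esub> a"] by simp
  qed
  have prime: "a * b \<in> A - P" if "a \<in> A - P" "b \<in> A - P" for a b
    using I_prime[of a b] mult that by (auto simp: simps)
  have nz: "s \<noteq> 0" if "s \<in> A - P" for s
    using that zero by auto
  have mem: "Fract a s \<in> {Fract a s |a s. a \<in> A \<and> s \<in> A - P}"
    if "a \<in> A" "s \<in> A - P" for a s
    using that by blast
  show ?thesis
    unfolding localization_def simps(1)
  proof (rule cring_subring_of_type)
    show "0 \<in> {Fract a s |a s. a \<in> A \<and> s \<in> A - P}"
      using zero one one' by (auto simp: Zero_fract_def)
    show "1 \<in> {Fract a s |a s. a \<in> A \<and> s \<in> A - P}"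
      using one one' by (auto simp: One_fract_def)
  next
    fix x y
    assume "x \<in> {Fract a s |a s. a \<in> A \<and> s \<in> A - P}"
      and "y \<in> {Fract a s |a s. a \<in> A \<and> s \<in> A - P}"
    then obtain a s b u where x: "x = Fract a s" "a \<in> A" "s \<in> A - P"
      and y: "y = Fract b u" "b \<in> A" "u \<in> A - P" by blast
    have "x + y = Fract (a * u + b * s) (s * u)"
      using x y nz by simp
    then show "x + y \<in> {Fract a s |a s. a \<in> A \<and> s \<in> A - P}"
      using add[OF mult[of a u] mult[of b s]] x(2,3) y(2,3) mem[OF _ prime[OF x(3) y(3)]]
      by simp
    have "x * y = Fract (a * b) (s * u)"
      using x y by simp
    then show "x * y \<in> {Fract a s |a s. a \<in> A \<and> s \<in> A - P}"
      using mem[OF mult[OF x(2) y(2)] prime[OF x(3) y(3)]] by simp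
  next
    fix x
    assume "x \<in> {Fract a s |a s. a \<in> A \<and> s \<in> A - P}"
    then obtain a s where "x = Fract a s" "a \<in> A" "s \<in> A - P" by blast
    then have "- x = Fract (- a) s \<and> - a \<in> A \<and> s \<in> A - P"
      using minus by simp
    then show "- x \<in> {Fract a s |a s. a \<in> A \<and> s \<in> A - P}" by blast
  qed
qed


section \<open>Edge ideals and cycles\<close>

text \<open>A graph is given by a vertex set and a set of two-element edges.\<close>

definition simple_graph :: "'v set \<Rightarrow> 'v set set \<Rightarrow> bool" where
  "simple_graph V E \<longleftrightarrow> finite V \<and> (\<forall>e\<in>E. e \<subseteq> V \<and> card e = 2)"

definition edge_ideal :: "nat set \<Rightarrow> nat set set \<Rightarrow> 'k::field mpoly set" where
  "edge_ideal V E = Idl\<^bsub>mpoly_ring V\<^esub> {mvar i * mvar j | i j. {i, j} \<in> E}"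

definition cycle_vertices :: "nat \<Rightarrow> nat set" where
  "cycle_vertices m = {1..m}"

definition cycle_edges :: "nat \<Rightarrow> nat set set" where
  "cycle_edges m = {{j, j + 1} | j. 1 \<le> j \<and> j \<le> m - 1} \<union> {{m, 1}}"

lemma simple_graph_cycle:
  assumes "m \<ge> 3"
  shows "simple_graph (cycle_vertices m) (cycle_edges m)"
  using assms by (auto simp: simple_graph_def cycle_vertices_def cycle_edges_def card_insert_if)

end

theory Submission
  imports Defs
begin

text \<open>
  For a minimal vertex cover \<open>C\<close> the variables in \<open>C\<close> generate an associated prime of the edge
  ideal \<open>I\<close>, so every monomial of an element of the symbolic power \<open>I\<^sup>(\<^sup>t\<^sup>)\<close> has degree at least \<open>t\<close>
  in the variables of \<open>C\<close>. It remains to see that such a monomial is divisible by a product of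
  \<open>t\<close> edges when \<open>t \<le> n\<close>. If all exponents are positive, \<open>n\<close> disjoint edges do; otherwise an exponent
  vanishes and the cycle degenerates to a path, where Koenig's theorem applies.
\<close>

section \<open>Polynomials and the grading by a set of variables\<close>

lemma mpoly_ring_simps:
  "carrier (mpoly_ring V) = {p. \<forall>m\<in>Poly_Mapping.keys p. Poly_Mapping.keys m \<subseteq> V}"
  "a \<otimes>\<^bsub>mpoly_ring V\<^esub> b = a * b"
  "a \<oplus>\<^bsub>mpoly_ring V\<^esub> b = a + b"
  "\<zero>\<^bsub>mpoly_ring V\<^esub> = 0"
  "\<one>\<^bsub>mpoly_ring V\<^esub> = 1"
  by (simp_all add: mpoly_ring_def subring_of_type_def)

text \<open>Closure under negation follows from absorption, because the inverse of \<open>a\<close>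
  is \<open>a\<close> times the inverse of one.\<close>

lemma ideal_subring_of_typeI:
  assumes "cring (subring_of_type A)" and sub: "J \<subseteq> A" and zero: "0 \<in> J"
    and add: "\<And>a b. a \<in> J \<Longrightarrow> b \<in> J \<Longrightarrow> a + b \<in> J"
    and mult: "\<And>a x. a \<in> J \<Longrightarrow> x \<in> A \<Longrightarrow> x * a \<in> J"
  shows "ideal J (subring_of_type A)"
proof -
  let ?R = "subring_of_type A"
  interpret cring ?R by fact
  have simps: "carrier ?R = A" "\<And>a b. a \<otimes>\<^bsub>?R\<^esub> b = a * b" "\<And>a b. a \<oplus>\<^bsub>?R\<^esub> b = a + b"
    "\<zero>\<^bsub>?R\<^esub> = 0" "\<one>\<^bsub>?R\<^esub> = 1"
    by (simp_all add: subring_of_type_def)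
  show ?thesis
  proof (rule idealI[OF ring_axioms])
    show "subgroup J (add_monoid ?R)"
    proof (rule add.subgroupI)
      fix a assume a: "a \<in> J"
      then have "a \<in> carrier ?R" using sub simps by auto
      then have "\<ominus>\<^bsub>?R\<^esub> a = (\<ominus>\<^bsub>?R\<^esub> \<one>\<^bsub>?R\<^esub>) \<otimes>\<^bsub>?R\<^esub> a"
        by (simp add: l_minus)
      moreover have "(\<ominus>\<^bsub>?R\<^esub> \<one>\<^bsub>?R\<^esub>) \<otimes>\<^bsub>?R\<^esub> a \<in> J"
        using mult[OF a, of "\<ominus>\<^bsub>?R\<^esub> \<one>\<^bsub>?R\<^esub>"] a_inv_closed[OF one_closed] by (simp add: simps(1,2))
      ultimately show "\<ominus>\<^bsub>?R\<^esub> a \<in> J" by simp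
    qed (use sub zero add in \<open>auto simp: simps\<close>)
  qed (use mult in \<open>auto simp: simps mult.commute\<close>)
qed

text \<open>Used to cut the part of lowest weight off a polynomial. The supports of \<open>q\<close>
  and \<open>r\<close> partition that of \<open>p\<close>, so no terms cancel.\<close>

lemma mpoly_split:
  fixes p :: "'a \<Rightarrow>\<^sub>0 'b::monoid_add"
  obtains q r where "p = q + r"
    and "Poly_Mapping.keys q = {m \<in> Poly_Mapping.keys p. P m}"
    and "Poly_Mapping.keys r = {m \<in> Poly_Mapping.keys p. \<not> P m}"
proof
  define part where
    "part Q = Abs_poly_mapping (\<lambda>m. if Q m then Poly_Mapping.lookup p m else 0)" for Q
  have part: "Poly_Mapping.lookup (part Q) m = (if Q m then Poly_Mapping.lookup p m else 0)" for Q m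
  proof -
    have "finite {m. (if Q m then Poly_Mapping.lookup p m else 0) \<noteq> 0}"
      by (rule finite_subset[OF _ finite_keys[of p]]) (auto simp: in_keys_iff split: if_splits)
    then show ?thesis by (simp add: part_def)
  qed
  show "p = part P + part (\<lambda>m. \<not> P m)"
    by (rule poly_mapping_eqI) (simp add: lookup_add part)
  show "Poly_Mapping.keys (part P) = {m \<in> Poly_Mapping.keys p. P m}"
    and "Poly_Mapping.keys (part (\<lambda>m. \<not> P m)) = {m \<in> Poly_Mapping.keys p. \<not> P m}"
    by (auto simp: in_keys_iff part split: if_splits)
qed

text \<open>The degree of a monomial in the variables indexed by \<open>C\<close>; an infinite
  \<open>C\<close> gives 0, the default value of a sum.\<close>

definition weight :: "nat set \<Rightarrow> (nat \<Rightarrow>\<^sub>0 nat) \<Rightarrow> nat" where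
  "weight C m = (\<Sum>i\<in>C. Poly_Mapping.lookup m i)"

lemma weight_add: "weight C (a + b) = weight C a + weight C b"
  by (simp add: weight_def lookup_add sum.distrib)

lemma weight_single: "finite C \<Longrightarrow> weight C (Poly_Mapping.single i k) = (if i \<in> C then k else 0)"
  by (simp add: weight_def lookup_single when_def)

text \<open>For finite \<open>C \<subseteq> V\<close> this is the \<open>t\<close>th power of the
  prime generated by the variables in \<open>C\<close>, encoded through monomials so that membership
  can be read off from exponents.\<close>

definition weight_ideal :: "nat set \<Rightarrow> nat set \<Rightarrow> nat \<Rightarrow> 'k::field mpoly set" where
  "weight_ideal V C t =
     {p \<in> carrier (mpoly_ring V). \<forall>m\<in>Poly_Mapping.keys p. t \<le> weight C m}"

lemma weight_ideal_mult:
  assumes "p \<in> weight_ideal V C s" "q \<in> weight_ideal V C t"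
  shows "p * q \<in> weight_ideal V C (s + t)"
proof -
  interpret cring "mpoly_ring V :: 'a mpoly ring" by (rule cring_mpoly_ring)
  have "p * q \<in> carrier (mpoly_ring V)"
    using assms m_closed[of p q] by (simp add: weight_ideal_def mpoly_ring_simps(2))
  moreover have "s + t \<le> weight C m" if m: "m \<in> Poly_Mapping.keys (p * q)" for m
  proof -
    obtain a b where "a \<in> Poly_Mapping.keys p" "b \<in> Poly_Mapping.keys q" "m = a + b"
      using m keys_mult[of p q] by blast
    then show ?thesis
      using assms by (auto simp: weight_ideal_def weight_add intro!: add_mono)
  qed
  ultimately show ?thesis by (simp add: weight_ideal_def)
qed

lemma weight_ideal_add:
  assumes "p \<in> weight_ideal V C t" "q \<in> weight_ideal V C t"
  shows "p + q \<in> weight_ideal V C t"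
proof -
  interpret cring "mpoly_ring V :: 'a mpoly ring" by (rule cring_mpoly_ring)
  have "p + q \<in> carrier (mpoly_ring V)"
    using assms a_closed[of p q] by (simp add: weight_ideal_def mpoly_ring_simps(3))
  then show ?thesis
    using assms Poly_Mapping.keys_add[of p q] by (auto simp: weight_ideal_def)
qed

text \<open>Makes absorption by ring elements the case of degree 0 of
  \<open>weight_ideal_mult\<close>.\<close>

lemma carrier_eq_weight_ideal: "carrier (mpoly_ring V) = weight_ideal V C 0"
  by (simp add: weight_ideal_def)

lemma ideal_weight_ideal: "ideal (weight_ideal V C t) (mpoly_ring V :: 'k::field mpoly ring)"
proof -
  let ?A = "{p :: 'k mpoly. \<forall>m\<in>Poly_Mapping.keys p. Poly_Mapping.keys m \<subseteq> V}"
  have "ideal (weight_ideal V C t) (subring_of_type ?A)"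
  proof (rule ideal_subring_of_typeI)
    show "cring (subring_of_type ?A)"
      using cring_mpoly_ring[of V] by (simp add: mpoly_ring_def)
    show "x * a \<in> weight_ideal V C t" if "a \<in> weight_ideal V C t" "x \<in> ?A" for a x
      using that weight_ideal_mult[of x V C 0 a t]
      by (simp add: carrier_eq_weight_ideal[symmetric] mpoly_ring_simps)
  qed (auto simp: weight_ideal_add, auto simp: weight_ideal_def mpoly_ring_simps)
  then show ?thesis by (simp add: mpoly_ring_def)
qed

text \<open>
  The parts of lowest weight of two polynomials have a nonzero product, which is the part of
  lowest weight of the product of the polynomials.
\<close>

lemma weight_ideal_cancel:
  fixes s f :: "'k::field mpoly"
  assumes f: "f \<in> carrier (mpoly_ring V)"
    and s: "m0 \<in> Poly_Mapping.keys s" "weight C m0 = 0"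
    and sf: "s * f \<in> weight_ideal V C t"
  shows "f \<in> weight_ideal V C t"
proof (rule ccontr)
  assume "f \<notin> weight_ideal V C t"
  then obtain m1 where m1: "m1 \<in> Poly_Mapping.keys f" "weight C m1 < t"
    using f by (auto simp: weight_ideal_def not_le)
  \<comment> \<open>The lowest weight occurring in \<open>f\<close>; the monomial \<open>m1\<close>
    forces it below \<open>t\<close>.\<close>
  define d where "d = Min (weight C ` Poly_Mapping.keys f)"
  have d_le: "d \<le> weight C m" if "m \<in> Poly_Mapping.keys f" for m
    using that by (simp add: d_def)
  have "d \<in> weight C ` Poly_Mapping.keys f"
    unfolding d_def using m1 by (intro Min_in) auto
  then obtain m2 where m2: "m2 \<in> Poly_Mapping.keys f" "weight C m2 = d" by blast
  have dt: "d < t" using d_le[OF m1(1)] m1(2) by simp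
  obtain s0 s1 where s_eq: "s = s0 + s1"
    and s0: "Poly_Mapping.keys s0 = {m \<in> Poly_Mapping.keys s. weight C m = 0}"
    and s1: "Poly_Mapping.keys s1 = {m \<in> Poly_Mapping.keys s. weight C m \<noteq> 0}"
    by (rule mpoly_split[of s "\<lambda>m. weight C m = 0"])
  obtain f0 f1 where f_eq: "f = f0 + f1"
    and f0: "Poly_Mapping.keys f0 = {m \<in> Poly_Mapping.keys f. weight C m = d}"
    and f1: "Poly_Mapping.keys f1 = {m \<in> Poly_Mapping.keys f. weight C m \<noteq> d}"
    by (rule mpoly_split[of f "\<lambda>m. weight C m = d"])
  \<comment> \<open>The monomials \<open>m0\<close> and \<open>m2\<close> survive in the lowest
    parts, and polynomials over a field have no zero divisors.\<close>
  have "s0 \<noteq> 0" "f0 \<noteq> 0" using s s0 m2 f0 by auto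
  then have "Poly_Mapping.keys (s0 * f0) \<noteq> {}" by simp
  then obtain m where m: "m \<in> Poly_Mapping.keys (s0 * f0)" by blast
  have wm: "weight C m = d"
    using m keys_mult[of s0 f0] by (auto simp: s0 f0 weight_add)
  \<comment> \<open>All other contributions to \<open>s * f\<close> are strictly heavier than
    \<open>d\<close>, so none of them can cancel \<open>m\<close>.\<close>
  have gt: "d < weight C u" if "u \<in> Poly_Mapping.keys (s0 * f1 + s1 * f)" for u
  proof -
    have "u \<in> Poly_Mapping.keys (s0 * f1) \<or> u \<in> Poly_Mapping.keys (s1 * f)"
      using that Poly_Mapping.keys_add[of "s0 * f1" "s1 * f"] by blast
    then show ?thesis
    proof
      assume "u \<in> Poly_Mapping.keys (s0 * f1)"
      then obtain a b where "a \<in> Poly_Mapping.keys s0" "b \<in> Poly_Mapping.keys f1" "u = a + b"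
        using keys_mult[of s0 f1] by blast
      then show ?thesis using d_le[of b] by (auto simp: f1 weight_add)
    next
      assume "u \<in> Poly_Mapping.keys (s1 * f)"
      then obtain a b where "a \<in> Poly_Mapping.keys s1" "b \<in> Poly_Mapping.keys f" "u = a + b"
        using keys_mult[of s1 f] by blast
      then show ?thesis using d_le[of b] by (auto simp: s1 weight_add)
    qed
  qed
  have "m \<notin> Poly_Mapping.keys (s0 * f1 + s1 * f)"
    using gt[of m] wm by auto
  moreover have "s * f = s0 * f0 + (s0 * f1 + s1 * f)"
    by (simp add: s_eq f_eq algebra_simps)
  ultimately have "m \<in> Poly_Mapping.keys (s * f)"
    using m by (simp add: in_keys_iff lookup_add)
  then show False
    using sf wm dt by (auto simp: weight_ideal_def)
qed

lemma weight_ideal_one_notin: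
  assumes "s \<in> carrier (mpoly_ring V)" "s \<notin> weight_ideal V C 1"
  obtains m where "m \<in> Poly_Mapping.keys s" "weight C m = 0"
  using assms by (auto simp: weight_ideal_def not_le)

text \<open>A factor outside the ideal has a monomial free of the variables in \<open>C\<close>,
  hence \<open>weight_ideal_cancel\<close> removes it from the product.\<close>

lemma primeideal_weight_ideal:
  "primeideal (weight_ideal V C 1) (mpoly_ring V :: 'k::field mpoly ring)"
proof (rule primeidealI[OF ideal_weight_ideal cring_mpoly_ring])
  have "(1 :: 'k mpoly) \<in> carrier (mpoly_ring V)"
    by (simp add: mpoly_ring_simps)
  moreover have "(1 :: 'k mpoly) \<notin> weight_ideal V C 1"
    by (auto simp: weight_ideal_def weight_def)
  ultimately show "carrier (mpoly_ring V) \<noteq> (weight_ideal V C 1 :: 'k mpoly set)" by blast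
  fix a b :: "'k mpoly"
  assume a: "a \<in> carrier (mpoly_ring V)" and b: "b \<in> carrier (mpoly_ring V)"
    and "a \<otimes>\<^bsub>mpoly_ring V\<^esub> b \<in> weight_ideal V C 1"
  then show "a \<in> weight_ideal V C 1 \<or> b \<in> weight_ideal V C 1"
    by (metis mpoly_ring_simps(2) weight_ideal_cancel weight_ideal_one_notin)
qed

section \<open>Powers of ideals and localization\<close>

lemma ideal_power_ideal:
  assumes "cring R" "ideal I R"
  shows "ideal (ideal_power R I t) R"
proof -
  interpret cring R by fact
  interpret M: comm_monoid "ideals_set R" by (rule ideals_set_is_comm_monoid)
  show ?thesis
    using M.nat_pow_closed[of I t] assms(2) by (simp add: ideals_set_def)
qed

lemma ideal_power_0: "ideal_power R I 0 = carrier R"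
  by (simp add: nat_pow_def ideals_set_def)

lemma ideal_power_Suc: "ideal_power R I (Suc t) = ideal_prod R (ideal_power R I t) I"
  by (simp add: nat_pow_def ideals_set_def)

lemma ideal_power_one:
  assumes "cring R" "ideal I R"
  shows "ideal_power R I 1 = I"
proof -
  interpret cring R by fact
  interpret M: comm_monoid "ideals_set R" by (rule ideals_set_is_comm_monoid)
  show ?thesis
    using M.nat_pow_Suc[of I 0] M.l_one[of I] assms(2) by (simp add: ideals_set_def)
qed

text \<open>The fraction with numerator \<open>f\<close> in the power and denominator 1 is already a
  generator of each extended ideal.\<close>

lemma ideal_power_subset_symbolic_power:
  assumes "cring R" "ideal I R"
  shows "ideal_power R I t \<subseteq> symbolic_power R I t"
  using ideal.Icarr[OF ideal_power_ideal[OF assms]]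
  by (auto simp: symbolic_power_def extended_ideal_def genideal_def)

text \<open>Clears denominators: the fractions with numerator in \<open>J\<close> and denominator
  outside \<open>P\<close> form an ideal of the localization that contains the image of
  \<open>J\<close>, hence all of the extended ideal.\<close>

lemma extended_ideal_memD:
  fixes J :: "'a::idom set"
  assumes R: "R = subring_of_type A" "primeideal P R" and J: "ideal J R"
    and f: "Fract f 1 \<in> extended_ideal R P J"
  obtains s where "s \<in> carrier R - P" "s * f \<in> J"
proof -
  interpret P: primeideal P R by fact
  interpret J: ideal J R by fact
  have cr: "cring (localization R P)"
    by (rule cring_localization[OF R])
  have simps: "carrier R = A" "\<And>a b. a \<otimes>\<^bsub>R\<^esub> b = a * b" "\<And>a b. a \<oplus>\<^bsub>R\<^esub> b = a + b"
    "\<zero>\<^bsub>R\<^esub> = 0" "\<one>\<^bsub>R\<^esub> = 1"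
    by (simp_all add: R subring_of_type_def)
  have one: "1 \<in> A - P"
    using P.one_closed P.one_imp_carrier P.I_notcarr by (auto simp: simps)
  have prime: "a * b \<in> A - P" if "a \<in> A - P" "b \<in> A - P" for a b
    using P.I_prime[of a b] P.m_closed[of a b] that by (auto simp: simps)
  have "0 \<in> P"
    using additive_subgroup.zero_closed[OF P.is_additive_subgroup] by (simp add: simps)
  then have nz: "s \<noteq> 0" if "s \<in> A - P" for s using that by auto
  have Jl: "x * a \<in> J" if "a \<in> J" "x \<in> A" for a x
    using J.I_l_closed[of a x] that by (simp add: simps)
  have Ja: "a + b \<in> J" if "a \<in> J" "b \<in> J" for a b
    using additive_subgroup.a_closed[OF J.is_additive_subgroup, of a b] that by (simp add: simps)
  have J0: "0 \<in> J" using additive_subgroup.zero_closed[OF J.is_additive_subgroup] by (simp add: simps)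
  have JA: "J \<subseteq> A" using J.Icarr by (auto simp: simps)
  define K where "K = {Fract a s | a s. a \<in> J \<and> s \<in> A - P}"
  have KI: "Fract a s \<in> K" if "a \<in> J" "s \<in> A - P" for a s
    using that by (auto simp: K_def)
  have "ideal K (localization R P)"
    unfolding localization_def
  proof (rule ideal_subring_of_typeI)
    show "cring (subring_of_type {Fract a s |a s. a \<in> carrier R \<and> s \<in> carrier R - P})"
      using cr by (simp add: localization_def)
    show "K \<subseteq> {Fract a s |a s. a \<in> carrier R \<and> s \<in> carrier R - P}"
      using JA by (auto simp: K_def simps)
    show "0 \<in> K" using KI[OF J0 one] by (simp add: Zero_fract_def)
    show "x + y \<in> K" if xy: "x \<in> K" "y \<in> K" for x y
    proof -
      obtain a s b u where x: "x = Fract a s" "a \<in> J" "s \<in> A - P"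
        and y: "y = Fract b u" "b \<in> J" "u \<in> A - P"
        using xy by (auto simp: K_def)
      have "x + y = Fract (u * a + s * b) (s * u)"
        using x y nz by (simp add: mult.commute)
      then show ?thesis
        using KI[OF Ja[OF Jl[of a u] Jl[of b s]] prime[of s u]] x y by simp
    qed
    show "x * y \<in> K" if xy: "y \<in> K" "x \<in> {Fract a s |a s. a \<in> carrier R \<and> s \<in> carrier R - P}" for x y
    proof -
      obtain a s b u where x: "x = Fract a s" "a \<in> A" "s \<in> A - P"
        and y: "y = Fract b u" "b \<in> J" "u \<in> A - P"
        using xy by (auto simp: K_def simps)
      then show ?thesis
        using KI[OF Jl[of b a] prime[of s u]] by simp
    qed
  qed
  moreover have "(\<lambda>a. Fract a 1) ` J \<subseteq> K"
    using KI one by auto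
  ultimately have "extended_ideal R P J \<subseteq> K"
    unfolding extended_ideal_def by (rule ring.genideal_minimal[OF cring.axioms(1)[OF cr]])
  then have "Fract f 1 \<in> K" using f by blast
  then obtain a s where as: "Fract f 1 = Fract a s" "a \<in> J" "s \<in> A - P"
    by (auto simp: K_def)
  \<comment> \<open>Equality of fractions is cross-multiplication here, since \<open>s\<close> is
    nonzero.\<close>
  then have "s * f = a"
    using nz[of s] by (simp add: eq_fract mult.commute)
  then show ?thesis
    using that[of s] as by (simp add: simps)
qed

section \<open>Edge ideals\<close>

definition vertex_cover :: "nat set set \<Rightarrow> nat set \<Rightarrow> bool" where
  "vertex_cover E C \<longleftrightarrow> (\<forall>e\<in>E. e \<inter> C \<noteq> {})"

text \<open>Minimality is phrased by deleting one vertex, the form that yields an edge met by the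
  cover in that vertex only.\<close>

lemma minimal_vertex_cover:
  assumes "finite C" "vertex_cover E C"
  obtains D where "D \<subseteq> C" "vertex_cover E D" "\<And>i. i \<in> D \<Longrightarrow> \<not> vertex_cover E (D - {i})"
proof -
  obtain D where D: "D \<subseteq> C" "vertex_cover E D"
    and min: "\<forall>B. B \<subseteq> C \<and> vertex_cover E B \<longrightarrow> B \<subseteq> D \<longrightarrow> D = B"
    using finite_has_minimal2[of "{D. D \<subseteq> C \<and> vertex_cover E D}" C] assms by auto
  have "\<not> vertex_cover E (D - {i})" if "i \<in> D" for i
    using min[rule_format, of "D - {i}"] D(1) that by auto
  with D show ?thesis by (rule that)
qed

section \<open>Monomials divisible by products of edges\<close>

abbreviation edge_exp :: "nat \<Rightarrow> nat \<Rightarrow> (nat \<Rightarrow>\<^sub>0 nat)" where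
  "edge_exp i j \<equiv> Poly_Mapping.single i 1 + Poly_Mapping.single j 1"

lemma mvar_mult: "mvar i * mvar j = (Poly_Mapping.single (edge_exp i j) 1 :: 'k::field mpoly)"
  by (simp add: mvar_def mult_single)

text \<open>Subtraction of exponents is truncated at 0; \<open>i \<noteq> j\<close> and the two
  bounds make it exact.\<close>

lemma edge_exp_split:
  fixes m :: "nat \<Rightarrow>\<^sub>0 nat"
  assumes "i \<noteq> j" "k \<le> Poly_Mapping.lookup m i" "k \<le> Poly_Mapping.lookup m j"
  shows "m = (m - (Poly_Mapping.single i k + Poly_Mapping.single j k))
             + (Poly_Mapping.single i k + Poly_Mapping.single j k)"
  using assms
  by (intro poly_mapping_eqI) (auto simp: lookup_add lookup_minus lookup_single when_def)

text \<open>Divisibility of a monomial by a product of \<open>t\<close> edges, repetitions allowed.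
  The base case takes an arbitrary monomial, the cofactor.\<close>

inductive edge_divisible :: "nat set set \<Rightarrow> nat \<Rightarrow> (nat \<Rightarrow>\<^sub>0 nat) \<Rightarrow> bool" for E where
  zero: "edge_divisible E 0 m"
| step: "edge_divisible E t m \<Longrightarrow> {i, j} \<in> E \<Longrightarrow> edge_divisible E (Suc t) (m + edge_exp i j)"

text \<open>Surplus edges are absorbed into the cofactor.\<close>

lemma edge_divisible_mono:
  assumes "edge_divisible E t m" "s \<le> t"
  shows "edge_divisible E s m"
  using assms
proof (induction arbitrary: s)
  case (zero m)
  then show ?case by (simp add: edge_divisible.zero)
next
  case (step t m i j)
  then show ?case
    by (cases s) (simp_all add: edge_divisible.intros del: One_nat_def)
qed

lemma edge_divisible_add:
  assumes "edge_divisible E t m" "{i, j} \<in> E"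
  shows "edge_divisible E (t + k) (m + (Poly_Mapping.single i k + Poly_Mapping.single j k))"
proof (induction k)
  case 0
  then show ?case using assms by simp
next
  case (Suc k)
  have "m + (Poly_Mapping.single i (Suc k) + Poly_Mapping.single j (Suc k))
      = (m + (Poly_Mapping.single i k + Poly_Mapping.single j k)) + edge_exp i j"
    by (intro poly_mapping_eqI) (simp add: lookup_add lookup_single when_def)
  then show ?case
    using edge_divisible.step[OF Suc.IH assms(2)] by simp
qed

lemma edge_divisible_Suc:
  assumes "{i, j} \<in> E" "i \<noteq> j" "0 < Poly_Mapping.lookup m i" "0 < Poly_Mapping.lookup m j"
    and "edge_divisible E t (m - edge_exp i j)"
  shows "edge_divisible E (Suc t) m"
  using edge_divisible.step[OF assms(5,1)] edge_exp_split[of i j 1 m] assms(2-4) by simp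

lemma mem_ideal_if_monomials:
  fixes p :: "'k::field mpoly"
  assumes "ideal J (mpoly_ring V)"
    and mono: "\<And>m. m \<in> Poly_Mapping.keys p \<Longrightarrow> Poly_Mapping.single m (Poly_Mapping.lookup p m) \<in> J"
  shows "p \<in> J"
proof -
  interpret ideal J "mpoly_ring V" by fact
  have "sum g A \<in> J" if "finite A" "\<And>m. m \<in> A \<Longrightarrow> g m \<in> J"
    for A :: "(nat \<Rightarrow>\<^sub>0 nat) set" and g
    using that
  proof (induction A rule: finite_induct)
    case empty
    then show ?case
      using additive_subgroup.zero_closed[OF is_additive_subgroup] by (simp add: mpoly_ring_simps)
  next
    case (insert x A)
    then show ?case
      using additive_subgroup.a_closed[OF is_additive_subgroup, of "g x" "sum g A"]
      by (simp add: mpoly_ring_simps)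
  qed
  then have "(\<Sum>m\<in>Poly_Mapping.keys p. Poly_Mapping.single m (Poly_Mapping.lookup p m)) \<in> J"
    using mono by simp
  moreover have "(\<Sum>m\<in>Poly_Mapping.keys p. Poly_Mapping.single m (Poly_Mapping.lookup p m)) = p"
    by (intro poly_mapping_eqI) (auto simp: lookup_sum lookup_single when_def in_keys_iff)
  ultimately show ?thesis by simp
qed

section \<open>Powers and associated primes of the edge ideal of a graph\<close>

locale finite_simple_graph =
  fixes V :: "nat set" and E :: "nat set set"
  assumes simple_graph: "simple_graph V E"
begin

lemma finite_V: "finite V" and E_subset: "e \<in> E \<Longrightarrow> e \<subseteq> V" and card_edge: "e \<in> E \<Longrightarrow> card e = 2"
  using simple_graph by (auto simp: simple_graph_def)

lemma edge_in_carrier: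
  assumes "{i, j} \<in> E"
  shows "Poly_Mapping.single (edge_exp i j) 1 \<in> (carrier (mpoly_ring V) :: 'k::field mpoly set)"
  using E_subset[OF assms]
    Poly_Mapping.keys_add[of "Poly_Mapping.single i (1::nat)" "Poly_Mapping.single j 1"]
  by (auto simp: mpoly_ring_simps)

lemma generators_subset:
  "{mvar i * mvar j | i j. {i, j} \<in> E} \<subseteq> (carrier (mpoly_ring V) :: 'k::field mpoly set)"
  using edge_in_carrier by (auto simp: mvar_mult simp del: One_nat_def)

lemma ideal_edge_ideal: "ideal (edge_ideal V E) (mpoly_ring V :: 'k::field mpoly ring)"
  unfolding edge_ideal_def
  by (rule ring.genideal_ideal[OF cring.axioms(1)[OF cring_mpoly_ring] generators_subset])

lemma edge_in_edge_ideal: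
  assumes "{i, j} \<in> E"
  shows "Poly_Mapping.single (edge_exp i j) 1 \<in> (edge_ideal V E :: 'k::field mpoly set)"
  unfolding edge_ideal_def
  by (rule subsetD[OF ring.genideal_self[OF cring.axioms(1)[OF cring_mpoly_ring] generators_subset]])
    (use assms in \<open>auto simp only: mvar_mult\<close>)

lemma edge_ideal_subset_weight_ideal:
  assumes C: "finite C" "vertex_cover E C"
  shows "(edge_ideal V E :: 'k::field mpoly set) \<subseteq> weight_ideal V C 1"
  unfolding edge_ideal_def
proof (rule ring.genideal_minimal[OF cring.axioms(1)[OF cring_mpoly_ring] ideal_weight_ideal])
  have "1 \<le> weight C (edge_exp i j)" if "{i, j} \<in> E" for i j
    using C that by (auto simp: weight_add weight_single vertex_cover_def)
  then show "{mvar i * mvar j |i j. {i, j} \<in> E} \<subseteq> (weight_ideal V C 1 :: 'k mpoly set)"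
    using edge_in_carrier by (auto simp: weight_ideal_def mvar_mult simp del: One_nat_def)
qed

text \<open>A cover meets every edge, so each generator has degree at least 1 in \<open>C\<close>,
  and degrees add up under multiplication.\<close>

lemma edge_ideal_power_subset_weight_ideal:
  assumes C: "finite C" "vertex_cover E C"
  shows "ideal_power (mpoly_ring V) (edge_ideal V E :: 'k::field mpoly set) t \<subseteq> weight_ideal V C t"
proof (induction t)
  case 0
  show ?case by (simp only: ideal_power_0 carrier_eq_weight_ideal[of V C] subset_refl)
next
  case (Suc t)
  show ?case
  proof
    fix p :: "'k mpoly"
    assume "p \<in> ideal_power (mpoly_ring V) (edge_ideal V E) (Suc t)"
    then show "p \<in> weight_ideal V C (Suc t)"
      unfolding ideal_power_Suc
    proof induction
      case (prod i j)
      then show ?case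
        using Suc edge_ideal_subset_weight_ideal[OF C] weight_ideal_mult[of i V C t j 1]
        by (auto simp: mpoly_ring_simps)
    qed (simp add: weight_ideal_add mpoly_ring_simps)
  qed
qed

text \<open>Each step of the derivation multiplies by one generator of the edge ideal; the
  coefficient \<open>c\<close> stays with the cofactor.\<close>

lemma monomial_in_edge_ideal_power:
  assumes "edge_divisible E t m" "Poly_Mapping.keys m \<subseteq> V"
  shows "Poly_Mapping.single m c \<in>
           ideal_power (mpoly_ring V) (edge_ideal V E :: 'k::field mpoly set) t"
  using assms
proof induction
  case (zero m)
  then show ?case unfolding ideal_power_0 by (auto simp: mpoly_ring_simps)
next
  case (step t m i j)
  have "Poly_Mapping.keys m \<subseteq> Poly_Mapping.keys (m + edge_exp i j)"
    by (auto simp: in_keys_iff lookup_add)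
  then have "Poly_Mapping.single m c \<in> ideal_power (mpoly_ring V) (edge_ideal V E :: 'k mpoly set) t"
    using step by auto
  from ideal_prod.prod[OF this edge_in_edge_ideal[OF step.hyps(2)], of "mpoly_ring V"]
  show ?case unfolding ideal_power_Suc by (simp add: mpoly_ring_simps mult_single)
qed

text \<open>Reduces membership in a power to combinatorics of exponents, since a polynomial is the
  sum of its terms.\<close>

lemma edge_ideal_powerI:
  fixes p :: "'k::field mpoly"
  assumes "p \<in> carrier (mpoly_ring V)"
    and "\<And>m. m \<in> Poly_Mapping.keys p \<Longrightarrow> edge_divisible E t m"
  shows "p \<in> ideal_power (mpoly_ring V) (edge_ideal V E) t"
  by (rule mem_ideal_if_monomials[OF ideal_power_ideal[OF cring_mpoly_ring ideal_edge_ideal]])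
    (use assms in \<open>auto simp: mpoly_ring_simps intro!: monomial_in_edge_ideal_power\<close>)

text \<open>
  The prime ideal generated by the variables in \<open>C\<close> is the annihilator, modulo the edge
  ideal, of the product of the variables outside \<open>C\<close>: by minimality every vertex of \<open>C\<close>
  has a neighbour outside \<open>C\<close>.
\<close>

lemma weight_ideal_in_Ass:
  assumes C: "C \<subseteq> V" "vertex_cover E C" "\<And>i. i \<in> C \<Longrightarrow> \<not> vertex_cover E (C - {i})"
  shows "weight_ideal V C 1 \<in> Ass (mpoly_ring V) (edge_ideal V E :: 'k::field mpoly set)"
proof -
  let ?R = "mpoly_ring V :: 'k mpoly ring"
  interpret I: ideal "edge_ideal V E :: 'k mpoly set" ?R by (rule ideal_edge_ideal)
  have finC: "finite C" using C finite_V finite_subset by blast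
  define u where "u = (\<Sum>i\<in>V - C. Poly_Mapping.single i (1::nat))"
  define f :: "'k mpoly" where "f = Poly_Mapping.single u 1"
  have lookup_u: "Poly_Mapping.lookup u i = (if i \<in> V - C then 1 else 0)" for i
    using finite_V by (simp add: u_def lookup_sum lookup_single when_def)
  have f: "f \<in> carrier ?R"
    by (auto simp: f_def mpoly_ring_simps in_keys_iff lookup_u split: if_splits)
  have u_weight: "weight C u = 0"
    by (simp add: weight_def lookup_u)
  have "a * f \<in> edge_ideal V E" if a: "a \<in> weight_ideal V C 1" for a
  proof -
    have "a \<otimes>\<^bsub>?R\<^esub> f \<in> carrier ?R"
      using a f by (intro I.m_closed) (simp_all add: weight_ideal_def)
    moreover have "edge_divisible E 1 k" if k_key: "k \<in> Poly_Mapping.keys (a * f)" for k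
    proof -
      obtain m where m: "m \<in> Poly_Mapping.keys a" and k: "k = m + u"
        using k_key keys_mult[of a f] by (auto simp: f_def)
      have "weight C m \<noteq> 0" using a m by (auto simp: weight_ideal_def)
      then obtain i where i: "i \<in> C" "0 < Poly_Mapping.lookup m i"
        unfolding weight_def by (meson gr0I sum.neutral)
      \<comment> \<open>Removing \<open>i\<close> uncovers some edge \<open>e\<close>. As
        \<open>C\<close> covers \<open>e\<close>, this edge contains \<open>i\<close>, and its other
        end lies outside \<open>C\<close> and so divides \<open>f\<close>.\<close>
      then obtain e where e: "e \<in> E" "e \<inter> (C - {i}) = {}"
        using C(3) by (auto simp: vertex_cover_def)
      have "i \<in> e" using e C(2) by (auto simp: vertex_cover_def)
      then obtain j where j: "e = {i, j}" "j \<noteq> i"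
        using card_edge[OF e(1)] by (auto simp: card_2_iff)
      then have "j \<in> V - C" using e E_subset by auto
      then show ?thesis
        using edge_divisible_Suc[of i j E k 0] e(1) i(2) j edge_divisible.zero
        by (simp add: k lookup_add lookup_u)
    qed
    ultimately have "a * f \<in> ideal_power ?R (edge_ideal V E) 1"
      by (intro edge_ideal_powerI) (simp_all add: mpoly_ring_simps(2))
    then show ?thesis
      by (simp only: ideal_power_one[OF cring_mpoly_ring ideal_edge_ideal])
  qed
  moreover have "a \<in> weight_ideal V C 1" if "a \<in> carrier ?R" "a * f \<in> edge_ideal V E" for a
  \<comment> \<open>The only monomial of \<open>f\<close> is \<open>u\<close>, of weight 0 in
    \<open>C\<close>, so \<open>f\<close> can be cancelled.\<close>
  proof (rule weight_ideal_cancel[OF that(1)])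
    show "u \<in> Poly_Mapping.keys f" by (simp add: f_def)
    show "f * a \<in> weight_ideal V C 1"
      using that(2) edge_ideal_subset_weight_ideal[OF finC C(2)] by (auto simp: mult.commute)
  qed (rule u_weight)
  ultimately have "weight_ideal V C 1 = {a \<in> carrier ?R. a \<otimes>\<^bsub>?R\<^esub> f \<in> edge_ideal V E}"
    by (auto simp: mpoly_ring_simps(2)) (simp add: weight_ideal_def)
  then show ?thesis
    unfolding Ass_def using primeideal_weight_ideal f by blast
qed

text \<open>Shrink \<open>C\<close> to a minimal cover \<open>D\<close>, whose prime is associated.
  Localizing there gives \<open>s\<close> outside this prime with \<open>s * f\<close> in the
  ordinary power, and \<open>s\<close> cancels. Passing from \<open>D\<close> back to
  \<open>C\<close> only raises degrees.\<close>

lemma weight_symbolic_power: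
  fixes f :: "'k::field mpoly"
  assumes f: "f \<in> symbolic_power (mpoly_ring V) (edge_ideal V E) t"
    and C: "C \<subseteq> V" "vertex_cover E C" and m: "m \<in> Poly_Mapping.keys f"
  shows "t \<le> weight C m"
proof -
  let ?R = "mpoly_ring V :: 'k mpoly ring"
  have finC: "finite C" using C finite_V finite_subset by blast
  obtain D where D: "D \<subseteq> C" "vertex_cover E D" "\<And>i. i \<in> D \<Longrightarrow> \<not> vertex_cover E (D - {i})"
    using minimal_vertex_cover[OF finC C(2)] by blast
  have finD: "finite D" using D finC finite_subset by blast
  let ?P = "weight_ideal V D 1 :: 'k mpoly set"
  have "?P \<in> Ass ?R (edge_ideal V E)"
    using weight_ideal_in_Ass[OF _ D(2,3)] D(1) C(1) by blast
  then have "Fract f 1 \<in> extended_ideal ?R ?P (ideal_power ?R (edge_ideal V E) t)"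
    using f by (auto simp: symbolic_power_def)
  then obtain s where s: "s \<in> carrier ?R - ?P" "s * f \<in> ideal_power ?R (edge_ideal V E) t"
    using extended_ideal_memD[OF mpoly_ring_def primeideal_weight_ideal
        ideal_power_ideal[OF cring_mpoly_ring ideal_edge_ideal]] by metis
  obtain m0 where "m0 \<in> Poly_Mapping.keys s" "weight D m0 = 0"
    using weight_ideal_one_notin s(1) by blast
  moreover have "s * f \<in> weight_ideal V D t"
    using s(2) edge_ideal_power_subset_weight_ideal[OF finD D(2)] by blast
  moreover have "f \<in> carrier ?R" using f by (simp add: symbolic_power_def)
  ultimately have "f \<in> weight_ideal V D t" by (metis weight_ideal_cancel)
  then have "t \<le> weight D m" using m by (simp add: weight_ideal_def)
  also have "\<dots> \<le> weight C m"
    unfolding weight_def using D(1) finC by (intro sum_mono2) auto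
  finally show ?thesis .
qed

end

section \<open>Weighted paths and odd cycles\<close>

text \<open>
  Koenig's theorem for weighted paths. The last edge is used as often as possible; this
  exhausts one of its endpoints, which is then added to the cover for free.
\<close>

lemma path_matching_cover:
  fixes \<phi> :: "nat \<Rightarrow> nat" and m :: "nat \<Rightarrow>\<^sub>0 nat"
  assumes "inj_on \<phi> {..N}" "\<And>p. p < N \<Longrightarrow> {\<phi> p, \<phi> (Suc p)} \<in> E"
  shows "\<exists>t C. edge_divisible E t m \<and> C \<subseteq> {..N} \<and> (\<forall>p<N. p \<in> C \<or> Suc p \<in> C)
            \<and> (\<Sum>p\<in>C. Poly_Mapping.lookup m (\<phi> p)) \<le> t"
  using assms
proof (induction N arbitrary: m)
  case 0
  have "edge_divisible E 0 m" by (rule edge_divisible.zero)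
  then show ?case by (intro exI[of _ 0] exI[of _ "{}"]) simp
next
  case (Suc N)
  define k where "k = min (Poly_Mapping.lookup m (\<phi> N)) (Poly_Mapping.lookup m (\<phi> (Suc N)))"
  define e where "e = Poly_Mapping.single (\<phi> N) k + Poly_Mapping.single (\<phi> (Suc N)) k"
  define m' where "m' = m - e"
  have inj: "\<phi> p = \<phi> q \<longleftrightarrow> p = q" if "p \<le> Suc N" "q \<le> Suc N" for p q
    using inj_onD[OF Suc.prems(1)] that by auto
  have m: "m = m' + e"
    unfolding m'_def e_def by (rule edge_exp_split) (auto simp: inj k_def)
  \<comment> \<open>On the shorter path only the exponent at its end \<open>\<phi> N\<close>
    changes.\<close>
  have look: "Poly_Mapping.lookup m (\<phi> p) = Poly_Mapping.lookup m' (\<phi> p) + (if p = N then k else 0)"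
    if "p \<le> N" for p
    using that by (simp add: m e_def lookup_add lookup_single when_def inj)
  have "inj_on \<phi> {..N}" using Suc.prems(1) by (rule inj_on_subset) auto
  then obtain t C where t: "edge_divisible E t m'" and C: "C \<subseteq> {..N}" "\<forall>p<N. p \<in> C \<or> Suc p \<in> C"
    and sum: "(\<Sum>p\<in>C. Poly_Mapping.lookup m' (\<phi> p)) \<le> t"
    using Suc.IH[of m'] Suc.prems(2) by auto
  have finC: "finite C" using C(1) finite_subset by blast
  have div: "edge_divisible E (t + k) m"
    using edge_divisible_add[OF t Suc.prems(2)[of N], of k] by (simp add: m e_def)
  have sumC: "(\<Sum>p\<in>C. Poly_Mapping.lookup m (\<phi> p))
      = (\<Sum>p\<in>C. Poly_Mapping.lookup m' (\<phi> p)) + (if N \<in> C then k else 0)"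
  proof -
    have "(\<Sum>p\<in>C. Poly_Mapping.lookup m (\<phi> p))
        = (\<Sum>p\<in>C. Poly_Mapping.lookup m' (\<phi> p) + (if p = N then k else 0))"
      using C(1) by (intro sum.cong) (auto simp: look)
    then show ?thesis using finC by (simp add: sum.distrib)
  qed
  have "k = Poly_Mapping.lookup m (\<phi> N) \<or> k = Poly_Mapping.lookup m (\<phi> (Suc N))"
    by (simp add: k_def min_def)
  \<comment> \<open>If \<open>N \<in> C\<close>, the last edge is covered and the cost of
    \<open>C\<close> grows by \<open>k\<close>. Otherwise the cost of \<open>C\<close> is unchanged,
    and an endpoint of exponent exactly \<open>k\<close> in \<open>m\<close> is added.\<close>
  then consider "N \<in> C" | "N \<notin> C" "k = Poly_Mapping.lookup m (\<phi> N)"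
    | "N \<notin> C" "k = Poly_Mapping.lookup m (\<phi> (Suc N))"
    by blast
  then have "\<exists>D. D \<subseteq> {..Suc N} \<and> (\<forall>p<Suc N. p \<in> D \<or> Suc p \<in> D)
            \<and> (\<Sum>p\<in>D. Poly_Mapping.lookup m (\<phi> p)) \<le> t + k"
  proof cases
    case 1
    then show ?thesis using C sum sumC
      by (intro exI[of _ C]) (auto simp: less_Suc_eq)
  next
    case 2
    then show ?thesis using C sum sumC finC
      by (intro exI[of _ "insert N C"]) (auto simp: less_Suc_eq)
  next
    case 3
    have "Suc N \<notin> C" using C(1) by auto
    then show ?thesis using 3 C sum sumC finC
      by (intro exI[of _ "insert (Suc N) C"]) (auto simp: less_Suc_eq)
  qed
  then show ?case using div by blast
qed

text \<open>Pairing consecutive positions gives disjoint edges, so splitting off the last pair keeps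
  all other exponents positive.\<close>

lemma path_perfect_matching:
  fixes \<phi> :: "nat \<Rightarrow> nat" and m :: "nat \<Rightarrow>\<^sub>0 nat"
  assumes "inj_on \<phi> {..<2 * n}" "\<And>p. Suc p < 2 * n \<Longrightarrow> {\<phi> p, \<phi> (Suc p)} \<in> E"
    and "\<And>p. p < 2 * n \<Longrightarrow> 0 < Poly_Mapping.lookup m (\<phi> p)"
  shows "edge_divisible E n m"
  using assms
proof (induction n arbitrary: m)
  case 0
  show ?case by (rule edge_divisible.zero)
next
  case (Suc n)
  let ?i = "\<phi> (2 * n)" and ?j = "\<phi> (Suc (2 * n))"
  have inj: "\<phi> p = \<phi> q \<longleftrightarrow> p = q" if "p < 2 * Suc n" "q < 2 * Suc n" for p q
    using inj_onD[OF Suc.prems(1)] that by auto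
  have "edge_divisible E n (m - edge_exp ?i ?j)"
  proof (rule Suc.IH)
    show "inj_on \<phi> {..<2 * n}" using Suc.prems(1) by (rule inj_on_subset) auto
    show "{\<phi> p, \<phi> (Suc p)} \<in> E" if "Suc p < 2 * n" for p
      using Suc.prems(2)[of p] that by simp
    show "0 < Poly_Mapping.lookup (m - edge_exp ?i ?j) (\<phi> p)" if "p < 2 * n" for p
      using Suc.prems(3)[of p] that by (simp add: lookup_minus lookup_add lookup_single when_def inj)
  qed
  then show ?case
    using Suc.prems(2)[of "2 * n"] Suc.prems(3)[of "2 * n"] Suc.prems(3)[of "Suc (2 * n)"]
    by (intro edge_divisible_Suc[of ?i ?j]) (auto simp: inj)
qed

text \<open>The bound \<open>t \<le> n\<close> serves the case of positive exponents, where the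
  cycle offers \<open>n\<close> disjoint edges. The cover condition serves the other case.\<close>

lemma odd_cycle_edge_divisible:
  fixes m :: "nat \<Rightarrow>\<^sub>0 nat"
  assumes "n \<ge> 1" "t \<le> n"
    and covers: "\<And>C. C \<subseteq> cycle_vertices (2 * n + 1) \<Longrightarrow> vertex_cover (cycle_edges (2 * n + 1)) C
                  \<Longrightarrow> t \<le> weight C m"
  shows "edge_divisible (cycle_edges (2 * n + 1)) t m"
proof (cases "\<forall>i\<in>cycle_vertices (2 * n + 1). 0 < Poly_Mapping.lookup m i")
  case True
  \<comment> \<open>With \<open>\<phi> = Suc\<close> the positions below \<open>2 * n\<close> run
    through the vertices from 1 to \<open>2 * n\<close>, leaving out the last vertex.\<close>
  have "edge_divisible (cycle_edges (2 * n + 1)) n m"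
    by (rule path_perfect_matching[where \<phi> = Suc])
      (use True in \<open>auto simp: cycle_edges_def cycle_vertices_def\<close>)
  then show ?thesis using assms(2) edge_divisible_mono by blast
next
  case False
  \<comment> \<open>Without \<open>v\<close> a path on \<open>2 * n\<close> vertices remains;
    \<open>?N\<close> is its number of edges and, counting from 0, its last position.\<close>
  let ?l = "2 * n + 1" and ?N = "2 * n - 1"
  obtain v where v: "1 \<le> v" "v \<le> ?l" "Poly_Mapping.lookup m v = 0"
    using False by (auto simp: cycle_vertices_def)
  \<comment> \<open>Walks around the cycle from the successor of \<open>v\<close>, wrapping from
    \<open>?l\<close> to 1.\<close>
  define \<phi> where "\<phi> p = (if v + p < ?l then v + p + 1 else v + p - 2 * n)" for p
  have inj: "inj_on \<phi> {..?N}"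
    using v assms(1) by (auto simp: inj_on_def \<phi>_def split: if_splits)
  have edge: "{\<phi> p, \<phi> (Suc p)} \<in> cycle_edges ?l" if p: "p < ?N" for p
  proof -
    consider "v + p < 2 * n" | "v + p = 2 * n" | "2 * n < v + p" by linarith
    then show ?thesis
    proof cases
      case 1
      then have "\<phi> p = v + p + 1" "\<phi> (Suc p) = v + p + 1 + 1" by (simp_all add: \<phi>_def)
      then show ?thesis using 1 by (force simp: cycle_edges_def)
    next
      case 2
      then have "\<phi> p = ?l" "\<phi> (Suc p) = 1" by (simp_all add: \<phi>_def)
      then show ?thesis by (simp add: cycle_edges_def)
    next
      case 3
      then have "\<phi> (Suc p) = \<phi> p + 1" "1 \<le> \<phi> p" "\<phi> p \<le> ?l - 1"
        using v p by (simp_all add: \<phi>_def)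
      then show ?thesis by (force simp: cycle_edges_def)
    qed
  qed
  \<comment> \<open>Conversely, each edge avoiding \<open>v\<close> lies on the path. The witnesses
    below solve \<open>\<phi> p = j\<close> before or after the wrap, or
    \<open>\<phi> p = ?l\<close> for the closing edge.\<close>
  have edge_of_path: "\<exists>p<?N. e = {\<phi> p, \<phi> (Suc p)}" if e: "e \<in> cycle_edges ?l" "v \<notin> e" for e
  proof -
    from e(1) consider j where "e = {j, j + 1}" "1 \<le> j" "j \<le> 2 * n" | "e = {?l, 1}"
      by (auto simp: cycle_edges_def)
    then show ?thesis
    proof cases
      case 1
      show ?thesis
      proof (cases "v < j")
        case True
        then show ?thesis using 1 v by (intro exI[of _ "j - v - 1"]) (auto simp: \<phi>_def)
      next
        case False
        then have "j + 1 < v" using 1 e(2) by auto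
        then show ?thesis using 1 v by (intro exI[of _ "j + 2 * n - v"]) (auto simp: \<phi>_def)
      qed
    next
      case 2
      then show ?thesis using e(2) v by (intro exI[of _ "2 * n - v"]) (auto simp: \<phi>_def)
    qed
  qed
  obtain t' C where t': "edge_divisible (cycle_edges ?l) t' m" and C: "C \<subseteq> {..?N}"
    "\<forall>p<?N. p \<in> C \<or> Suc p \<in> C" "(\<Sum>p\<in>C. Poly_Mapping.lookup m (\<phi> p)) \<le> t'"
    using path_matching_cover[OF inj edge] by blast
  \<comment> \<open>The vertex \<open>v\<close> covers the two edges missing from the path and costs
    nothing, its exponent being 0.\<close>
  define D where "D = insert v (\<phi> ` C)"
  have "D \<subseteq> cycle_vertices ?l"
    using C(1) v assms(1) by (fastforce simp: D_def cycle_vertices_def \<phi>_def)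
  moreover have "vertex_cover (cycle_edges ?l) D"
    unfolding vertex_cover_def
  proof
    fix e assume e: "e \<in> cycle_edges ?l"
    show "e \<inter> D \<noteq> {}"
    proof (cases "v \<in> e")
      case False
      then obtain p where "p < ?N" "e = {\<phi> p, \<phi> (Suc p)}" using edge_of_path[OF e] by blast
      then show ?thesis using C(2) by (auto simp: D_def)
    qed (simp add: D_def)
  qed
  ultimately have "t \<le> weight D m" by (rule covers)
  also have "\<dots> \<le> (\<Sum>i\<in>\<phi> ` C. Poly_Mapping.lookup m i)"
    using v(3) finite_subset[OF C(1)]
    by (cases "v \<in> \<phi> ` C") (simp_all add: D_def weight_def insert_absorb)
  also have "\<dots> = (\<Sum>p\<in>C. Poly_Mapping.lookup m (\<phi> p))"
    using inj_on_subset[OF inj C(1)] by (simp add: sum.reindex)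
  also have "\<dots> \<le> t'" by (rule C(3))
  finally show ?thesis using t' edge_divisible_mono by blast
qed

theorem corollary5p3:
  fixes n t :: nat
    and I :: "'k::alg_closed_field mpoly set"
  assumes "n \<ge> 1"
    and "I = edge_ideal (cycle_vertices (2 * n + 1)) (cycle_edges (2 * n + 1))"
    and "1 \<le> t" and "t \<le> n"
  shows "symbolic_power (mpoly_ring (cycle_vertices (2 * n + 1))) I t
       = ideal_power (mpoly_ring (cycle_vertices (2 * n + 1))) I t"
proof -
  let ?V = "cycle_vertices (2 * n + 1)" and ?E = "cycle_edges (2 * n + 1)"
  \<comment> \<open>The hypothesis \<open>n \<ge> 1\<close> provides the three vertices that a
    simple cycle requires.\<close>
  interpret finite_simple_graph ?V ?E
    by unfold_locales (rule simple_graph_cycle, use assms(1) in simp)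
  show ?thesis
    unfolding assms(2)
  proof
    show "ideal_power (mpoly_ring ?V) (edge_ideal ?V ?E :: 'k mpoly set) t
        \<subseteq> symbolic_power (mpoly_ring ?V) (edge_ideal ?V ?E) t"
      by (rule ideal_power_subset_symbolic_power[OF cring_mpoly_ring ideal_edge_ideal])
    show "symbolic_power (mpoly_ring ?V) (edge_ideal ?V ?E :: 'k mpoly set) t
        \<subseteq> ideal_power (mpoly_ring ?V) (edge_ideal ?V ?E) t"
    proof
      fix f :: "'k mpoly"
      assume f: "f \<in> symbolic_power (mpoly_ring ?V) (edge_ideal ?V ?E) t"
      show "f \<in> ideal_power (mpoly_ring ?V) (edge_ideal ?V ?E) t"
      proof (rule edge_ideal_powerI)
        show "f \<in> carrier (mpoly_ring ?V)" using f by (simp add: symbolic_power_def)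
        \<comment> \<open>Every cover bounds the degree of \<open>m\<close> from below by
          \<open>t\<close>, which is the hypothesis of the combinatorial lemma.\<close>
        show "edge_divisible ?E t m" if "m \<in> Poly_Mapping.keys f" for m
          using odd_cycle_edge_divisible[OF assms(1,4)] weight_symbolic_power[OF f _ _ that] by blast
      qed
    qed
  qed
qed

end
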